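(* Let $n\geq 3$ and let $D_n=\langle r,s \mid r^n=s^2=rsrs=e\rangle$ be the dihedral group of order $2n$. If $n$ is odd, Player 1 has a winning strategy for $\texttt{REL}(D_n,\{r,s\})$. If $n$ is even, Player 1 has a winning strategy for $\texttt{REL}(D_n,\{r,s\})$ when $n\equiv 2 \pmod 6$, and Player 2 has a winning strategy otherwise.
   Context: Game $\texttt{REL}(G,S)$: $G$ is a finite group and $S$ a generating set with $e\notin S$. Two players alternate turns, Player 1 first, starting from the empty word $w_0$. On turn $n$ the current player chooses $s_n\in S\cup S^{-1}$, subject to $s_n\neq s_{n-1}^{-1}$ when $n>1$, and forms $w_n=w_{n-1}s_n$. If $w_n$ represents the same element of $G$ as some $w_k$ with $0\le k<n$, the player who formed $w_n$ wins. If a player has no legal move, that player loses. *)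

theory Defs
  imports "HOL-Algebra.Generated_Groups" "HOL-Number_Theory.Cong"
begin

section \<open>Groups given by generators and relators\<close>

text \<open>A letter \<open>(x, True)\<close> stands for the generator \<open>x\<close> and \<open>(x, False)\<close> for its formal inverse.\<close>

type_synonym 'g gword = "('g \<times> bool) list"

inductive rel_eq :: "'g gword set \<Rightarrow> 'g gword \<Rightarrow> 'g gword \<Rightarrow> bool"
  for R :: "'g gword set" where
  refl: "rel_eq R u u"
| sym: "rel_eq R u v \<Longrightarrow> rel_eq R v u"
| trans: "rel_eq R u v \<Longrightarrow> rel_eq R v w \<Longrightarrow> rel_eq R u w"
| cong: "rel_eq R u v \<Longrightarrow> rel_eq R (x @ u @ y) (x @ v @ y)"
| cancel: "rel_eq R [(a, b), (a, \<not> b)] []"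
| relator: "w \<in> R \<Longrightarrow> rel_eq R w []"

definition gword_class :: "'g gword set \<Rightarrow> 'g gword \<Rightarrow> 'g gword set" where
  "gword_class R u = {v. rel_eq R u v}"

text \<open>The group \<open>\<langle>UNIV | R\<rangle>\<close>, generated by all elements of the type \<open>'g\<close>.\<close>

definition presented_group :: "'g gword set \<Rightarrow> 'g gword set monoid" where
  "presented_group R =
    \<lparr>carrier = range (gword_class R),
     monoid.mult = (\<lambda>A B. \<Union>u\<in>A. \<Union>v\<in>B. gword_class R (u @ v)),
     monoid.one = gword_class R []\<rparr>"

definition presented_gen :: "'g gword set \<Rightarrow> 'g \<Rightarrow> 'g gword set" where
  "presented_gen R x = gword_class R [(x, True)]"


section \<open>The dihedral groups\<close>

datatype dihedral_gen = Rot | Flip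

definition dihedral_relators :: "nat \<Rightarrow> dihedral_gen gword set" where
  "dihedral_relators n =
    {replicate n (Rot, True),
     replicate 2 (Flip, True),
     [(Rot, True), (Flip, True), (Rot, True), (Flip, True)]}"

definition dihedral_group :: "nat \<Rightarrow> dihedral_gen gword set monoid" where
  "dihedral_group n = presented_group (dihedral_relators n)"

definition dihedral_r :: "nat \<Rightarrow> dihedral_gen gword set" where
  "dihedral_r n = presented_gen (dihedral_relators n) Rot"

definition dihedral_s :: "nat \<Rightarrow> dihedral_gen gword set" where
  "dihedral_s n = presented_gen (dihedral_relators n) Flip"


section \<open>The game REL\<close>

datatype player = Player1 | Player2

fun opponent :: "player \<Rightarrow> player" where
  "opponent Player1 = Player2"
| "opponent Player2 = Player1"

text \<open>A game state is the list \<open>[s\<^sub>1, \<dots>, s\<^sub>m]\<close> of group elements chosen so far; \<open>w\<^sub>k\<close> is the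
  value of its prefix of length \<open>k\<close>.\<close>

definition word_value :: "('a, 'b) monoid_scheme \<Rightarrow> 'a list \<Rightarrow> 'a" where
  "word_value G ms = foldl (\<lambda>w s. w \<otimes>\<^bsub>G\<^esub> s) \<one>\<^bsub>G\<^esub> ms"

definition player_to_move :: "'a list \<Rightarrow> player" where
  "player_to_move ms = (if even (length ms) then Player1 else Player2)"

definition legal_move :: "('a, 'b) monoid_scheme \<Rightarrow> 'a set \<Rightarrow> 'a list \<Rightarrow> 'a \<Rightarrow> bool" where
  "legal_move G S ms s \<longleftrightarrow>
     s \<in> S \<union> m_inv G ` S \<and> (ms \<noteq> [] \<longrightarrow> s \<noteq> m_inv G (last ms))"

definition closes_relator :: "('a, 'b) monoid_scheme \<Rightarrow> 'a list \<Rightarrow> bool" where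
  "closes_relator G ms \<longleftrightarrow> (\<exists>k<length ms. word_value G ms = word_value G (take k ms))"

inductive rel_position :: "('a, 'b) monoid_scheme \<Rightarrow> 'a set \<Rightarrow> 'a list \<Rightarrow> bool"
  for G :: "('a, 'b) monoid_scheme" and S :: "'a set" where
  start: "rel_position G S []"
| move: "rel_position G S ms \<Longrightarrow> \<not> closes_relator G ms \<Longrightarrow> legal_move G S ms s
          \<Longrightarrow> rel_position G S (ms @ [s])"

definition rel_over :: "('a, 'b) monoid_scheme \<Rightarrow> 'a set \<Rightarrow> 'a list \<Rightarrow> bool" where
  "rel_over G S ms \<longleftrightarrow> closes_relator G ms \<or> (\<nexists>s. legal_move G S ms s)"

definition rel_winner :: "('a, 'b) monoid_scheme \<Rightarrow> 'a list \<Rightarrow> player" where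
  "rel_winner G ms =
     (if closes_relator G ms then player_to_move (butlast ms) else opponent (player_to_move ms))"

definition follows :: "player \<Rightarrow> ('a list \<Rightarrow> 'a) \<Rightarrow> 'a list \<Rightarrow> bool" where
  "follows p \<sigma> ms \<longleftrightarrow>
     (\<forall>k<length ms. player_to_move (take k ms) = p \<longrightarrow> ms ! k = \<sigma> (take k ms))"

text \<open>Over a finite group there are no infinite plays (see \<open>rel_position_length\<close> below), so it
  suffices to consider finished positions. The first conjunct prevents a strategy from winning
  vacuously by prescribing illegal moves.\<close>

definition winning_strategy ::
    "('a, 'b) monoid_scheme \<Rightarrow> 'a set \<Rightarrow> player \<Rightarrow> ('a list \<Rightarrow> 'a) \<Rightarrow> bool" where
  "winning_strategy G S p \<sigma> \<longleftrightarrow>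
     (\<forall>ms. rel_position G S ms \<and> follows p \<sigma> ms \<and> \<not> rel_over G S ms \<and> player_to_move ms = p
            \<longrightarrow> legal_move G S ms (\<sigma> ms)) \<and>
     (\<forall>ms. rel_position G S ms \<and> follows p \<sigma> ms \<and> rel_over G S ms \<longrightarrow> rel_winner G ms = p)"

definition has_winning_strategy ::
    "('a, 'b) monoid_scheme \<Rightarrow> 'a set \<Rightarrow> player \<Rightarrow> bool" where
  "has_winning_strategy G S p \<longleftrightarrow> (\<exists>\<sigma>. winning_strategy G S p \<sigma>)"


section \<open>The definitions are well behaved\<close>

lemma word_value_carrier:
  assumes "group G" "set ms \<subseteq> carrier G"
  shows "word_value G ms \<in> carrier G"
proof -
  interpret group G by fact
  show ?thesis using assms(2)
    by (induction ms rule: rev_induct) (auto simp: word_value_def)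
qed

lemma rel_position_length:
  assumes "group G" "finite (carrier G)" "S \<subseteq> carrier G" "rel_position G S ms"
  shows "length ms \<le> card (carrier G)"
proof -
  interpret group G by fact
  have *: "set ms \<subseteq> carrier G \<and> inj_on (\<lambda>k. word_value G (take k ms)) {..<length ms}"
    using assms(4)
  proof induction
    case start
    then show ?case by simp
  next
    case (move ms s)
    have "set (ms @ [s]) \<subseteq> carrier G"
      using move assms(3) by (auto simp: legal_move_def)
    moreover have "inj_on (\<lambda>k. word_value G (take k (ms @ [s]))) {..<length (ms @ [s])}"
    proof -
      have "inj_on (\<lambda>k. word_value G (take k ms)) (insert (length ms) {..<length ms})"
        using move.IH move.hyps(2) by (subst inj_on_insert) (force simp: closes_relator_def)
      then have "inj_on (\<lambda>k. word_value G (take k ms)) {..<length (ms @ [s])}"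
        by (simp add: lessThan_Suc)
      then show ?thesis by (simp add: inj_on_def)
    qed
    ultimately show ?case by blast
  qed
  have "(\<lambda>k. word_value G (take k ms)) ` {..<length ms} \<subseteq> carrier G"
    using * word_value_carrier[OF assms(1)] by (meson image_subsetI order_trans set_take_subset)
  then have "card {..<length ms} \<le> card (carrier G)"
    using * assms(2) by (meson card_inj_on_le)
  then show ?thesis by simp
qed

lemma rel_eq_append:
  assumes "rel_eq R u u'" "rel_eq R v v'"
  shows "rel_eq R (u @ v) (u' @ v')"
proof (rule rel_eq.trans)
  show "rel_eq R (u @ v) (u' @ v)" using rel_eq.cong[OF assms(1), of "[]" v] by simp
  show "rel_eq R (u' @ v) (u' @ v')" using rel_eq.cong[OF assms(2), of u' "[]"] by simp
qed

lemma gword_class_eq_iff: "gword_class R u = gword_class R v \<longleftrightarrow> rel_eq R u v"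
proof
  assume "gword_class R u = gword_class R v"
  moreover have "v \<in> gword_class R v" by (simp add: gword_class_def rel_eq.refl)
  ultimately have "v \<in> gword_class R u" by simp
  then show "rel_eq R u v" by (simp add: gword_class_def)
next
  assume uv: "rel_eq R u v"
  show "gword_class R u = gword_class R v"
    unfolding gword_class_def
    using rel_eq.trans[OF uv] rel_eq.trans[OF rel_eq.sym[OF uv]] by (intro Collect_cong iffI)
qed

lemma presented_group_one: "\<one>\<^bsub>presented_group R\<^esub> = gword_class R []"
  by (simp add: presented_group_def)

lemma gword_class_mult:
  "gword_class R u \<otimes>\<^bsub>presented_group R\<^esub> gword_class R v = gword_class R (u @ v)"
proof -
  have *: "gword_class R (u' @ v') = gword_class R (u @ v)"
    if "u' \<in> gword_class R u" "v' \<in> gword_class R v" for u' v'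
    unfolding gword_class_eq_iff using that
    by (simp add: gword_class_def rel_eq.sym rel_eq_append)
  have ne: "gword_class R u \<noteq> {}" "gword_class R v \<noteq> {}"
    using rel_eq.refl by (auto simp: gword_class_def)
  have "(\<Union>u'\<in>gword_class R u. \<Union>v'\<in>gword_class R v. gword_class R (u' @ v')) =
        (\<Union>u'\<in>gword_class R u. \<Union>v'\<in>gword_class R v. gword_class R (u @ v))"
    by (intro SUP_cong HOL.refl *)
  then show ?thesis using ne by (simp add: presented_group_def)
qed

lemma rel_eq_inverse:
  "rel_eq R (rev (map (\<lambda>(a, b). (a, \<not> b)) u) @ u) []"
proof (induction u)
  case Nil
  then show ?case by (simp add: rel_eq.refl)
next
  case (Cons x u)
  obtain a b where x: "x = (a, b)" by force
  have "rel_eq R [(a, \<not> b), (a, b)] []" using rel_eq.cancel[of R a "\<not> b"] by simp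
  from rel_eq.trans[OF rel_eq.cong[OF this, of "rev (map (\<lambda>(a, b). (a, \<not> b)) u)" u]] Cons
  show ?case unfolding x by simp
qed

lemma group_presented_group: "group (presented_group R)"
proof (rule groupI)
  let ?P = "presented_group R"
  have carr: "carrier ?P = range (gword_class R)" and one: "\<one>\<^bsub>?P\<^esub> = gword_class R []"
    by (simp_all add: presented_group_def)
  show "\<exists>y\<in>carrier ?P. y \<otimes>\<^bsub>?P\<^esub> x = \<one>\<^bsub>?P\<^esub>" if x: "x \<in> carrier ?P" for x
  proof -
    obtain u where "x = gword_class R u" using x carr by auto
    then have "gword_class R (rev (map (\<lambda>(a, b). (a, \<not> b)) u)) \<otimes>\<^bsub>?P\<^esub> x = \<one>\<^bsub>?P\<^esub>"
      by (simp add: gword_class_mult one gword_class_eq_iff rel_eq_inverse)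
    then show ?thesis using carr by blast
  qed
next
  fix x y z
  let ?P = "presented_group R"
  have carr: "carrier ?P = range (gword_class R)" by (simp add: presented_group_def)
  show "\<one>\<^bsub>?P\<^esub> \<in> carrier ?P" by (simp add: carr presented_group_one)
  assume "x \<in> carrier ?P"
  then obtain u where u: "x = gword_class R u" by (auto simp: carr)
  show "\<one>\<^bsub>?P\<^esub> \<otimes>\<^bsub>?P\<^esub> x = x" by (simp add: u presented_group_one gword_class_mult)
  assume "y \<in> carrier ?P"
  then obtain v where v: "y = gword_class R v" by (auto simp: carr)
  show "x \<otimes>\<^bsub>?P\<^esub> y \<in> carrier ?P" by (simp add: u v carr gword_class_mult)
  assume "z \<in> carrier ?P"
  then obtain w where w: "z = gword_class R w" by (auto simp: carr)
  show "x \<otimes>\<^bsub>?P\<^esub> y \<otimes>\<^bsub>?P\<^esub> z = x \<otimes>\<^bsub>?P\<^esub> (y \<otimes>\<^bsub>?P\<^esub> z)"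
    by (simp add: u v w gword_class_mult)
qed

lemma gword_class_pow:
  fixes k :: nat
  shows "gword_class R [x] [^]\<^bsub>presented_group R\<^esub> k = gword_class R (replicate k x)"
proof (induction k)
  case 0
  interpret group "presented_group R" by (rule group_presented_group)
  show ?case by (simp add: presented_group_one)
next
  case (Suc k)
  interpret group "presented_group R" by (rule group_presented_group)
  show ?case using Suc by (simp add: gword_class_mult replicate_append_same)
qed

lemma group_dihedral_group: "group (dihedral_group n)"
  unfolding dihedral_group_def by (rule group_presented_group)

text \<open>Right multiplication by a letter in the model of pairs \<open>(i, e)\<close>, which represent
  \<open>r\<^sup>i s\<^sup>e\<close>.\<close>

fun dihedral_act :: "nat \<Rightarrow> int \<times> bool \<Rightarrow> dihedral_gen \<times> bool \<Rightarrow> int \<times> bool" where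
  "dihedral_act n (i, e) (Rot, b) = ((if b = e then i - 1 else i + 1) mod int n, e)"
| "dihedral_act n (i, e) (Flip, b) = (i mod int n, \<not> e)"

lemma dihedral_act_range:
  assumes "n > 0" "fst p \<in> {0..<int n}"
  shows "fst (foldl (dihedral_act n) p u) \<in> {0..<int n}"
proof (induction u rule: rev_induct)
  case (snoc x u)
  obtain i e where "foldl (dihedral_act n) p u = (i, e)" by force
  then show ?case using assms(1) by (cases x; cases "fst x") auto
qed (use assms in simp)

lemma dihedral_act_rotations:
  assumes "i \<in> {0..<int n}"
  shows "foldl (dihedral_act n) (i, e) (replicate k (Rot, True)) =
           ((if e then i - int k else i + int k) mod int n, e)"
proof (induction k)
  case (Suc k)
  have "replicate (Suc k) (Rot, True) = replicate k (Rot, True) @ [(Rot, True)]"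
    by (simp add: replicate_append_same)
  then show ?case using Suc by (auto simp: mod_simps algebra_simps simp del: replicate_Suc)
qed (use assms in auto)

lemma dihedral_act_rel_eq:
  assumes "rel_eq (dihedral_relators n) u v" "n > 0" "fst p \<in> {0..<int n}"
  shows "foldl (dihedral_act n) p u = foldl (dihedral_act n) p v"
  using assms(1,3)
proof (induction arbitrary: p)
  case (cong u v x y)
  then show ?case using dihedral_act_range[OF assms(2)] by simp
next
  case (cancel a b)
  then show ?case by (cases p; cases a) (auto simp: mod_simps)
next
  case (relator w)
  obtain i e where p: "p = (i, e)" by force
  have i: "i \<in> {0..<int n}" using relator p by simp
  consider "w = replicate n (Rot, True)" | "w = [(Flip, True), (Flip, True)]"
    | "w = [(Rot, True), (Flip, True), (Rot, True), (Flip, True)]"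
    using relator by (auto simp: dihedral_relators_def numeral_2_eq_2)
  then show ?case
  proof cases
    case 1
    then show ?thesis using dihedral_act_rotations[OF i] i p by auto
  qed (use i p in \<open>auto simp: mod_simps\<close>)
qed auto

lemma dihedral_relations:
  fixes n
  defines "G \<equiv> dihedral_group n" and "r \<equiv> dihedral_r n" and "s \<equiv> dihedral_s n"
  shows "r \<in> carrier G" "s \<in> carrier G"
    "r [^]\<^bsub>G\<^esub> n = \<one>\<^bsub>G\<^esub>" "s [^]\<^bsub>G\<^esub> (2::nat) = \<one>\<^bsub>G\<^esub>"
    "r \<otimes>\<^bsub>G\<^esub> s \<otimes>\<^bsub>G\<^esub> r \<otimes>\<^bsub>G\<^esub> s = \<one>\<^bsub>G\<^esub>"
proof -
  interpret group G unfolding G_def by (rule group_dihedral_group)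
  let ?R = "dihedral_relators n"
  note defs = G_def r_def s_def dihedral_group_def dihedral_r_def dihedral_s_def presented_gen_def
  show "r \<in> carrier G" "s \<in> carrier G" by (simp_all add: defs presented_group_def)
  have one: "\<one>\<^bsub>G\<^esub> = gword_class ?R []" by (simp add: defs presented_group_def)
  have pow: "gword_class ?R [(x, True)] [^]\<^bsub>G\<^esub> k = gword_class ?R (replicate k (x, True))"
    for x and k :: nat
    unfolding G_def dihedral_group_def by (rule gword_class_pow)
  have rel: "gword_class ?R w = \<one>\<^bsub>G\<^esub>" if "w \<in> ?R" for w
    using that by (simp add: one gword_class_eq_iff rel_eq.relator)
  show "r [^]\<^bsub>G\<^esub> n = \<one>\<^bsub>G\<^esub>" "s [^]\<^bsub>G\<^esub> (2::nat) = \<one>\<^bsub>G\<^esub>"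
    unfolding r_def s_def dihedral_r_def dihedral_s_def presented_gen_def pow
    by (rule rel, simp add: dihedral_relators_def)+
  show "r \<otimes>\<^bsub>G\<^esub> s \<otimes>\<^bsub>G\<^esub> r \<otimes>\<^bsub>G\<^esub> s = \<one>\<^bsub>G\<^esub>"
    using rel[of "[(Rot, True), (Flip, True), (Rot, True), (Flip, True)]"]
    by (simp add: defs gword_class_mult dihedral_relators_def)
qed

lemma presented_group_inv_letter:
  "gword_class R [(a, False)] = m_inv (presented_group R) (gword_class R [(a, True)])"
proof -
  interpret group "presented_group R" by (rule group_presented_group)
  have "gword_class R [(a, False)] \<otimes>\<^bsub>presented_group R\<^esub> gword_class R [(a, True)]
          = \<one>\<^bsub>presented_group R\<^esub>"
    using rel_eq.cancel[of R a False]
    by (simp add: gword_class_mult gword_class_eq_iff presented_group_one)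
  then show ?thesis
    by (intro inv_equality[symmetric]) (auto simp: presented_group_def)
qed

lemma presented_group_generate:
  "generate (presented_group R) (range (presented_gen R)) = carrier (presented_group R)"
proof -
  let ?P = "presented_group R"
  interpret group ?P by (rule group_presented_group)
  have sub: "range (presented_gen R) \<subseteq> carrier ?P"
    by (auto simp: presented_gen_def presented_group_def)
  have "gword_class R u \<in> generate ?P (range (presented_gen R))" for u
  proof (induction u rule: rev_induct)
    case Nil
    then show ?case using generate.one[of ?P] by (simp add: presented_group_def)
  next
    case (snoc x u)
    obtain a b where x: "x = (a, b)" by force
    have "gword_class R [x] \<in> generate ?P (range (presented_gen R))"
    proof (cases b)
      case True
      then show ?thesis unfolding x by (intro generate.incl) (auto simp: presented_gen_def)
    next
      case False
      then show ?thesis unfolding x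
        using generate.inv[of "presented_gen R a" "range (presented_gen R)" ?P]
        by (simp add: presented_group_inv_letter presented_gen_def)
    qed
    from generate.eng[OF snoc this] show ?case by (simp add: gword_class_mult)
  qed
  then show ?thesis using generate_incl[OF sub] by (auto simp: presented_group_def)
qed

lemma UNIV_dihedral_gen: "UNIV = {Rot, Flip}"
  using dihedral_gen.exhaust by auto

lemma dihedral_generate:
  "generate (dihedral_group n) {dihedral_r n, dihedral_s n} = carrier (dihedral_group n)"
proof -
  have "range (presented_gen (dihedral_relators n)) = {dihedral_r n, dihedral_s n}"
    by (simp add: UNIV_dihedral_gen dihedral_r_def dihedral_s_def)
  then show ?thesis
    using presented_group_generate[of "dihedral_relators n"] by (simp add: dihedral_group_def)
qed

lemma dihedral_generators_not_one:
  assumes "n \<ge> 2"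
  shows "\<one>\<^bsub>dihedral_group n\<^esub> \<notin> {dihedral_r n, dihedral_s n}"
proof -
  have "\<not> rel_eq (dihedral_relators n) [] [(x, True)]" for x
    using dihedral_act_rel_eq[of n "[]" "[(x, True)]" "(0, False)"] assms by (cases x) auto
  then show ?thesis
    by (auto simp: dihedral_group_def presented_group_def dihedral_r_def dihedral_s_def
        presented_gen_def gword_class_eq_iff)
qed

lemma dihedral_normal_form:
  fixes n u
  defines "G \<equiv> dihedral_group n" and "r \<equiv> dihedral_r n" and "s \<equiv> dihedral_s n"
  defines "p \<equiv> foldl (dihedral_act n) (0, False) u"
  shows "gword_class (dihedral_relators n) u =
           r [^]\<^bsub>G\<^esub> fst p \<otimes>\<^bsub>G\<^esub> (if snd p then s else \<one>\<^bsub>G\<^esub>)"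
proof -
  interpret group G unfolding G_def by (rule group_dihedral_group)
  let ?R = "dihedral_relators n"
  note rels = dihedral_relations[of n, folded G_def r_def s_def]
  note [simp] = rels(1,2)
  have modn: "r [^]\<^bsub>G\<^esub> (i mod int n) = r [^]\<^bsub>G\<^esub> i" for i :: int
  proof -
    have "r [^]\<^bsub>G\<^esub> (int n * (i div int n)) = (r [^]\<^bsub>G\<^esub> int n) [^]\<^bsub>G\<^esub> (i div int n)"
      by (simp only: int_pow_pow rels(1))
    also have "\<dots> = \<one>\<^bsub>G\<^esub>" using rels(3) by (simp add: int_pow_int)
    finally have "r [^]\<^bsub>G\<^esub> (int n * (i div int n) + i mod int n) = r [^]\<^bsub>G\<^esub> (i mod int n)"
      using int_pow_mult[OF rels(1), of "int n * (i div int n)" "i mod int n"] by simp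
    then show ?thesis by simp
  qed
  have ss: "s \<otimes>\<^bsub>G\<^esub> s = \<one>\<^bsub>G\<^esub>"
    using rels(4) by (simp add: numeral_2_eq_2)
  then have inv_s: "inv\<^bsub>G\<^esub> s = s" by (simp add: inv_equality)
  have "r \<otimes>\<^bsub>G\<^esub> (s \<otimes>\<^bsub>G\<^esub> r \<otimes>\<^bsub>G\<^esub> s) = \<one>\<^bsub>G\<^esub>"
    using rels(5) by (simp add: m_assoc)
  then have inv_srs: "inv\<^bsub>G\<^esub> (s \<otimes>\<^bsub>G\<^esub> r \<otimes>\<^bsub>G\<^esub> s) = r"
    by (simp add: inv_equality)
  have "s \<otimes>\<^bsub>G\<^esub> r \<otimes>\<^bsub>G\<^esub> s = inv\<^bsub>G\<^esub> (inv\<^bsub>G\<^esub> (s \<otimes>\<^bsub>G\<^esub> r \<otimes>\<^bsub>G\<^esub> s))" by simp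
  then have srs: "s \<otimes>\<^bsub>G\<^esub> r \<otimes>\<^bsub>G\<^esub> s = inv\<^bsub>G\<^esub> r" unfolding inv_srs .
  have sr: "s \<otimes>\<^bsub>G\<^esub> r = inv\<^bsub>G\<^esub> r \<otimes>\<^bsub>G\<^esub> s"
    unfolding srs[symmetric] by (simp add: m_assoc ss)
  have "s \<otimes>\<^bsub>G\<^esub> inv\<^bsub>G\<^esub> r = (s \<otimes>\<^bsub>G\<^esub> s) \<otimes>\<^bsub>G\<^esub> (r \<otimes>\<^bsub>G\<^esub> s)"
    unfolding srs[symmetric] by (simp add: m_assoc)
  then have sr': "s \<otimes>\<^bsub>G\<^esub> inv\<^bsub>G\<^esub> r = r \<otimes>\<^bsub>G\<^esub> s" by (simp add: ss)
  have plus: "r [^]\<^bsub>G\<^esub> (i + 1) = r [^]\<^bsub>G\<^esub> i \<otimes>\<^bsub>G\<^esub> r"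
    and minus: "r [^]\<^bsub>G\<^esub> (i - 1) = r [^]\<^bsub>G\<^esub> i \<otimes>\<^bsub>G\<^esub> inv\<^bsub>G\<^esub> r" for i :: int
    using int_pow_mult[OF rels(1), of i 1] int_pow_diff[OF rels(1), of i 1] int_pow_1[OF rels(1)]
    by simp_all
  have letters: "gword_class ?R [(Rot, b)] = (if b then r else inv\<^bsub>G\<^esub> r)"
    "gword_class ?R [(Flip, b)] = s" for b
    using inv_s presented_group_inv_letter[of ?R]
    by (cases b; simp add: G_def r_def s_def dihedral_group_def dihedral_r_def dihedral_s_def
        presented_gen_def)+
  define N where "N = (\<lambda>p. r [^]\<^bsub>G\<^esub> (fst p :: int) \<otimes>\<^bsub>G\<^esub> (if snd p then s else \<one>\<^bsub>G\<^esub>))"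
  have step: "N p \<otimes>\<^bsub>G\<^esub> gword_class ?R [x] = N (dihedral_act n p x)" for p x
  proof -
    obtain i e where p: "p = (i, e)" by force
    obtain a b where x: "x = (a, b)" by force
    show ?thesis
      by (cases a; cases b; cases e)
        (simp_all add: p x N_def letters modn plus minus m_assoc sr sr' ss)
  qed
  have "gword_class ?R u = N (foldl (dihedral_act n) (0, False) u)"
  proof (induction u rule: rev_induct)
    case Nil
    have "gword_class ?R [] = \<one>\<^bsub>G\<^esub>"
      by (simp add: G_def dihedral_group_def presented_group_one)
    then show ?case by (simp add: N_def)
  next
    case (snoc x u)
    have "gword_class ?R (u @ [x]) = gword_class ?R u \<otimes>\<^bsub>G\<^esub> gword_class ?R [x]"
      by (simp add: G_def dihedral_group_def gword_class_mult)
    then show ?case using snoc step by simp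
  qed
  then show ?thesis unfolding N_def p_def .
qed

lemma order_dihedral_group:
  assumes "n > 0"
  shows "order (dihedral_group n) = 2 * n"
proof -
  let ?R = "dihedral_relators n" and ?X = "{0..<int n} \<times> (UNIV :: bool set)"
  let ?ev = "foldl (dihedral_act n) (0, False)"
  define f where "f = (\<lambda>(i :: int, e). replicate (nat i) (Rot, True) @ (if e then [(Flip, True)] else []))"
  have ev_f: "?ev (f p) = p" if "p \<in> ?X" for p
    using that dihedral_act_rotations[of 0 n False] assms by (cases p) (auto simp: f_def)
  have ev_in: "?ev u \<in> ?X" for u
    using dihedral_act_range[of n "(0, False)" u] assms by (simp add: mem_Times_iff)
  have "bij_betw (\<lambda>p. gword_class ?R (f p)) ?X (carrier (dihedral_group n))"
    unfolding bij_betw_def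
  proof
    show "inj_on (\<lambda>p. gword_class ?R (f p)) ?X"
    proof (rule inj_onI)
      fix p q assume pq: "p \<in> ?X" "q \<in> ?X" "gword_class ?R (f p) = gword_class ?R (f q)"
      then have "?ev (f p) = ?ev (f q)"
        using assms by (intro dihedral_act_rel_eq) (simp_all add: gword_class_eq_iff)
      then show "p = q" by (simp only: ev_f pq(1,2))
    qed
    have "gword_class ?R u \<in> (\<lambda>p. gword_class ?R (f p)) ` ?X" for u
    proof (rule image_eqI[OF _ ev_in])
      show "gword_class ?R u = gword_class ?R (f (?ev u))"
        unfolding dihedral_normal_form[of n "f (?ev u)"] ev_f[OF ev_in]
        by (rule dihedral_normal_form)
    qed
    then have "range (gword_class ?R) \<subseteq> (\<lambda>p. gword_class ?R (f p)) ` ?X" by (rule image_subsetI)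
    moreover have "(\<lambda>p. gword_class ?R (f p)) ` ?X \<subseteq> range (gword_class ?R)"
      by (intro image_subsetI rangeI)
    ultimately show "(\<lambda>p. gword_class ?R (f p)) ` ?X = carrier (dihedral_group n)"
      by (simp only: dihedral_group_def presented_group_def partial_object.simps set_eq_subset)
  qed
  from bij_betw_same_card[OF this] show ?thesis
    by (simp add: order_def card_cartesian_product)
qed

end

theory Submission
  imports Defs
begin

text \<open>The Cayley graph is a prism, two \<open>n\<close>-cycles joined by rungs, and a play is a
  non-backtracking walk which we lift to the infinite ladder. Stepping next to an earlier vertex lets
  the opponent close a cycle at once, so the walk must run around in one direction; crossing a rung
  in column \<open>c\<close> forces two further steps, and the crosser's opponent moves next in column \<open>c + 2\<close>.
  If the walk opens with a rotation, the cycle can only be closed in the starting row and the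
  outcome is a matter of parity. If it opens with a flip, it can be closed in both rows and what
  remains is the subtraction game in which one or two columns are removed per turn.\<close>

section \<open>The game on the infinite ladder\<close>

text \<open>Vertex \<open>(i, e)\<close> stands for \<open>r\<^sup>i s\<^sup>e\<close>, and walks are listed with the current vertex first.\<close>

fun ladder_step :: "int \<times> bool \<Rightarrow> dihedral_gen \<times> bool \<Rightarrow> int \<times> bool" where
  "ladder_step (i, e) (Rot, b) = (if b = e then i - 1 else i + 1, e)"
| "ladder_step (i, e) (Flip, b) = (i, \<not> e)"

text \<open>The ban on undoing a letter becomes a ban on returning to the previous vertex. This
  treats both formal letters of \<open>Flip\<close> alike.\<close>

definition ladder_move :: "(int \<times> bool) list \<Rightarrow> int \<times> bool \<Rightarrow> bool" where
  "ladder_move w y \<longleftrightarrow> (\<exists>x. y = ladder_step (hd w) x) \<and> (tl w \<noteq> [] \<longrightarrow> y \<noteq> hd (tl w))"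

text \<open>The size of the prism enters the rules only here: the ladder is its infinite cyclic
  cover, and reducing columns modulo \<open>N\<close> projects back.\<close>

definition ladder_closes :: "int \<Rightarrow> (int \<times> bool) list \<Rightarrow> bool" where
  "ladder_closes N w \<longleftrightarrow> (\<exists>y\<in>set (tl w). [fst (hd w) = fst y] (mod N) \<and> snd (hd w) = snd y)"

text \<open>Outcomes for the player about to move. A player without moves satisfies
  \<open>loses\<close> vacuously, as the rules demand.\<close>

inductive wins :: "int \<Rightarrow> (int \<times> bool) list \<Rightarrow> bool"
  and loses :: "int \<Rightarrow> (int \<times> bool) list \<Rightarrow> bool"
  for N :: int where
  wins_close: "ladder_move w y \<Longrightarrow> ladder_closes N (y # w) \<Longrightarrow> wins N w"
| wins_move: "ladder_move w y \<Longrightarrow> loses N (y # w) \<Longrightarrow> wins N w"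
| loses: "(\<And>y. ladder_move w y \<Longrightarrow> \<not> ladder_closes N (y # w))
    \<Longrightarrow> (\<And>y. ladder_move w y \<Longrightarrow> wins N (y # w)) \<Longrightarrow> loses N w"

text \<open>The twist in row \<open>True\<close> only swaps which rotation letter moves forward, so
  the neighbours are those of an untwisted ladder.\<close>

lemma ladder_move_Cons:
  "ladder_move ((k, e) # w) y \<longleftrightarrow>
     y \<in> {(k + 1, e), (k - 1, e), (k, \<not> e)} \<and> (w \<noteq> [] \<longrightarrow> y \<noteq> hd w)"
proof -
  have "(\<exists>x. y = ladder_step (k, e) x) \<longleftrightarrow> y \<in> {(k + 1, e), (k - 1, e), (k, \<not> e)}"
  proof
    assume "\<exists>x. y = ladder_step (k, e) x"
    then obtain a b where "y = ladder_step (k, e) (a, b)" by auto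
    then show "y \<in> {(k + 1, e), (k - 1, e), (k, \<not> e)}" by (cases a) (auto split: if_splits)
  next
    assume "y \<in> {(k + 1, e), (k - 1, e), (k, \<not> e)}"
    then have "y = ladder_step (k, e) (Rot, \<not> e) \<or> y = ladder_step (k, e) (Rot, e)
      \<or> y = ladder_step (k, e) (Flip, True)" by auto
    then show "\<exists>x. y = ladder_step (k, e) x" by blast
  qed
  then show ?thesis by (simp add: ladder_move_def)
qed

lemma ladder_closes_Cons:
  "ladder_closes N ((k, e) # w) \<longleftrightarrow> (\<exists>j. (j, e) \<in> set w \<and> [k = j] (mod N))"
  by (force simp: ladder_closes_def)

lemma ladder_closes_mem: "(k, e) \<in> set w \<Longrightarrow> ladder_closes N ((k, e) # w)"
  by (auto simp: ladder_closes_Cons)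

lemma ladder_closes_wrap: "(0, e) \<in> set w \<Longrightarrow> ladder_closes N ((N, e) # w)"
  by (auto simp: ladder_closes_Cons cong_def)

text \<open>Within the columns from 0 to \<open>N - 1\<close> congruent means equal, so only a
  literal revisit closes a cycle.\<close>

lemma not_ladder_closes:
  assumes "(k, e) \<notin> set w" "\<forall>y\<in>set w. 0 \<le> fst y \<and> fst y < N" "0 \<le> k" "k < N"
  shows "\<not> ladder_closes N ((k, e) # w)"
  using assms by (force simp: ladder_closes_Cons cong_def)

lemma not_ladder_closes_wrap:
  assumes "(0, e) \<notin> set w" "\<forall>y\<in>set w. 0 \<le> fst y \<and> fst y < N"
  shows "\<not> ladder_closes N ((N, e) # w)"
proof
  assume "ladder_closes N ((N, e) # w)"
  then obtain j where j: "(j, e) \<in> set w" "[N = j] (mod N)" by (auto simp: ladder_closes_Cons)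
  then have "0 \<le> j" "j < N" using assms(2) by force+
  with j(2) have "j = 0" by (simp add: cong_def)
  with j(1) assms(1) show False by simp
qed

section \<open>Reflection in column 0\<close>

definition mirror :: "int \<times> bool \<Rightarrow> int \<times> bool" where
  "mirror y = (- fst y, snd y)"

lemma mirror_mirror [simp]: "mirror (mirror y) = y"
  by (simp add: mirror_def)

lemma ladder_move_mirror:
  assumes "w \<noteq> []"
  shows "ladder_move (map mirror w) y \<longleftrightarrow> ladder_move w (mirror y)"
proof -
  obtain k e w' where w: "w = (k, e) # w'" using assms by (cases w) auto
  show ?thesis
    by (cases y; cases w') (auto simp: w mirror_def ladder_move_Cons)
qed

lemma ladder_closes_mirror:
  assumes "w \<noteq> []"
  shows "ladder_closes N (map mirror w) \<longleftrightarrow> ladder_closes N w"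
  using assms by (cases w) (auto simp: ladder_closes_def mirror_def cong_minus_minus_iff)

text \<open>Reflection preserves moves and closing, so induction over the rules transfers outcomes.
  Runs towards negative columns are thereby covered by forward runs.\<close>

lemma wins_loses_mirror:
  shows "wins N w \<Longrightarrow> w \<noteq> [] \<Longrightarrow> wins N (map mirror w)"
    and "loses N w \<Longrightarrow> w \<noteq> [] \<Longrightarrow> loses N (map mirror w)"
proof (induction rule: wins_loses.inducts)
  case (wins_close w y)
  then show ?case
    using wins_loses.wins_close[of "map mirror w" "mirror y" N] ladder_closes_mirror[of "y # w" N]
    by (simp add: ladder_move_mirror)
next
  case (wins_move w y)
  then show ?case
    using wins_loses.wins_move[of "map mirror w" "mirror y" N] by (simp add: ladder_move_mirror)
next
  case (loses w)
  show ?case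
  proof (rule wins_loses.loses)
    fix y assume "ladder_move (map mirror w) y"
    then have m: "ladder_move w (mirror y)" using loses by (simp add: ladder_move_mirror)
    show "\<not> ladder_closes N (y # map mirror w)"
      using loses(1)[OF m] ladder_closes_mirror[of "mirror y # w" N] by simp
    show "wins N (y # map mirror w)" using loses(3)[OF m] by simp
  qed
qed


section \<open>Monotone runs\<close>

text \<open>The walk has just stepped forward into the new column \<open>c\<close>, and the vertex
  \<open>(c - 1, \<not> e)\<close> is unvisited, so that flipping does not hand over an immediate win.\<close>

definition forward_run :: "int \<Rightarrow> bool \<Rightarrow> (int \<times> bool) list \<Rightarrow> bool" where
  "forward_run c e w \<longleftrightarrow> (\<exists>v. w = (c, e) # (c - 1, e) # v \<and> (c - 1, \<not> e) \<notin> set v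
     \<and> (\<forall>y\<in>set ((c - 1, e) # v). 0 \<le> fst y \<and> fst y < c))"

lemma forward_runE:
  assumes "forward_run c e w"
  obtains v where "w = (c, e) # (c - 1, e) # v" "(c - 1, \<not> e) \<notin> set v" "1 \<le> c"
    "\<And>k f. (k, f) \<in> set v \<Longrightarrow> 0 \<le> k \<and> k < c"
  using assms unfolding forward_run_def by fastforce

lemma forward_run_step:
  assumes "forward_run c e w"
  shows "forward_run (c + 1) e ((c + 1, e) # w)"
  using assms by (elim forward_runE) (force simp: forward_run_def)

text \<open>All earlier columns are at most \<open>c\<close>, so \<open>(c + 1, e)\<close> is still
  unvisited after a flip and two steps in the other row, and the invariant is restored.\<close>

lemma forward_run_jump:
  assumes "forward_run c e w"
  shows "forward_run (c + 2) (\<not> e) ((c + 2, \<not> e) # (c + 1, \<not> e) # (c, \<not> e) # w)"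
  using assms by (elim forward_runE) (force simp: forward_run_def)

text \<open>The third neighbour \<open>(c - 1, e)\<close> is the previous vertex, so a step and a
  flip are the only moves to refute.\<close>

lemma forward_run_loses:
  assumes run: "forward_run c e w"
    and "\<not> ladder_closes N ((c + 1, e) # w)" "wins N ((c + 1, e) # w)"
    and "\<not> ladder_closes N ((c, \<not> e) # w)" "wins N ((c, \<not> e) # w)"
  shows "loses N w"
  by (rule forward_runE[OF run], rule loses) (use assms in \<open>auto simp: ladder_move_Cons\<close>)

lemma not_closes_step:
  assumes "forward_run c e w" "c + 1 < N"
  shows "\<not> ladder_closes N ((c + 1, e) # w)"
  using assms by (elim forward_runE) (rule not_ladder_closes; fastforce)

lemma not_closes_flip:
  assumes "forward_run c e w" "c < N"
  shows "\<not> ladder_closes N ((c, \<not> e) # w)"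
  using assms by (elim forward_runE) (rule not_ladder_closes; fastforce)

section \<open>Forced play after a flip\<close>

text \<open>Turning back to \<open>(c - 1, \<not> e)\<close> lets the opponent flip onto the visited
  \<open>(c - 1, e)\<close>, so the forward step is the only reply left to examine.\<close>

lemma loses_after_flip:
  assumes run: "forward_run c e w" and "c + 1 < N"
    and wins: "wins N ((c + 1, \<not> e) # (c, \<not> e) # w)"
  shows "loses N ((c, \<not> e) # w)"
proof (rule forward_runE[OF run])
  fix v assume v: "w = (c, e) # (c - 1, e) # v" "(c - 1, \<not> e) \<notin> set v" "1 \<le> c"
    "\<And>k f. (k, f) \<in> set v \<Longrightarrow> 0 \<le> k \<and> k < c"
  let ?F = "(c, \<not> e) # w"
  show ?thesis
  proof (rule loses)
    fix y assume "ladder_move ?F y"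
    then consider "y = (c + 1, \<not> e)" | "y = (c - 1, \<not> e)"
      by (auto simp: ladder_move_Cons v)
    then have "\<not> ladder_closes N (y # ?F) \<and> wins N (y # ?F)"
    proof cases
      case 1
      have "\<not> ladder_closes N ((c + 1, \<not> e) # ?F)"
        by (rule not_ladder_closes) (use v assms(2) in \<open>fastforce+\<close>)
      with 1 wins show ?thesis by simp
    next
      case 2
      have "\<not> ladder_closes N ((c - 1, \<not> e) # ?F)"
        by (rule not_ladder_closes) (use v assms(2) in \<open>fastforce+\<close>)
      moreover have "wins N ((c - 1, \<not> e) # ?F)"
        by (rule wins_close[of _ "(c - 1, e)"])
          (auto simp: v ladder_move_Cons intro: ladder_closes_mem)
      ultimately show ?thesis using 2 by simp
    qed
    then show "\<not> ladder_closes N (y # ?F)" "wins N (y # ?F)" by simp_all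
  qed
qed

text \<open>The player answering the flip steps to \<open>(c + 1, \<not> e)\<close>. Flipping back
  from there loses to a step onto the visited \<open>(c, e)\<close>, so the flipper must step on to
  column \<open>c + 2\<close>. That column may be \<open>N\<close>, hence the separate assumption
  \<open>nc\<close>.\<close>

lemma wins_after_flip:
  assumes run: "forward_run c e w" and "c + 1 < N"
    and nc: "\<not> ladder_closes N ((c + 2, \<not> e) # (c + 1, \<not> e) # (c, \<not> e) # w)"
    and wins: "wins N ((c + 2, \<not> e) # (c + 1, \<not> e) # (c, \<not> e) # w)"
  shows "wins N ((c, \<not> e) # w)"
proof (rule forward_runE[OF run])
  fix v assume v: "w = (c, e) # (c - 1, e) # v" "(c - 1, \<not> e) \<notin> set v" "1 \<le> c"
    "\<And>k f. (k, f) \<in> set v \<Longrightarrow> 0 \<le> k \<and> k < c"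
  let ?G = "(c + 1, \<not> e) # (c, \<not> e) # w"
  have "loses N ?G"
  proof (rule loses)
    fix y assume "ladder_move ?G y"
    then consider "y = (c + 2, \<not> e)" | "y = (c + 1, e)"
      by (auto simp: ladder_move_Cons)
    then have "\<not> ladder_closes N (y # ?G) \<and> wins N (y # ?G)"
    proof cases
      case 1
      then show ?thesis using nc wins by simp
    next
      case 2
      have "\<not> ladder_closes N ((c + 1, e) # ?G)"
        by (rule not_ladder_closes) (use v assms(2) in \<open>fastforce+\<close>)
      moreover have "wins N ((c + 1, e) # ?G)"
        by (rule wins_close[of _ "(c, e)"])
          (auto simp: v ladder_move_Cons intro: ladder_closes_mem)
      ultimately show ?thesis using 2 by simp
    qed
    then show "\<not> ladder_closes N (y # ?G)" "wins N (y # ?G)" by simp_all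
  qed
  then show ?thesis by (intro wins_move[of _ "(c + 1, \<not> e)"]) (auto simp: ladder_move_Cons v)
qed

lemma forward_run_move:
  assumes "forward_run c e w"
  shows "ladder_move w (c + 1, e)" "ladder_move w (c, \<not> e)"
  using assms by (auto elim!: forward_runE simp: ladder_move_Cons)

lemma not_closes_jump:
  assumes "forward_run c e w" "c + 2 < N"
  shows "\<not> ladder_closes N ((c + 2, \<not> e) # (c + 1, \<not> e) # (c, \<not> e) # w)"
  using assms by (elim forward_runE) (rule not_ladder_closes; fastforce)

text \<open>Both a step and a flip followed by its two forced steps change the parity of
  \<open>N - c + e\<close>, so the choice between the two is immaterial.\<close>

lemma open_start_outcome:
  assumes "forward_run c e w" "c < N" "(0, False) \<in> set w" "(0, True) \<notin> set w"
  shows "(even (N - c + of_bool e) \<longrightarrow> loses N w) \<and> (odd (N - c + of_bool e) \<longrightarrow> wins N w)"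
  using assms
proof (induction "nat (N - c)" arbitrary: c e w rule: less_induct)
  case less
  note run = less.prems(1) and start = less.prems(3,4)
  note [simp] = forward_run_move[OF run]
  obtain v where v: "w = (c, e) # (c - 1, e) # v" "1 \<le> c"
    and cols: "\<forall>y\<in>set w. 0 \<le> fst y \<and> fst y \<le> c"
    by (rule forward_runE[OF run]) fastforce
  \<comment> \<open>Reaching \<open>(N, True)\<close> without closing hands over the win: the reply
    flips to \<open>(N, False)\<close>, a copy of the starting vertex.\<close>
  have wrap: "wins N ((N, True) # u)" if "(0, False) \<in> set u" "u \<noteq> []" "hd u \<noteq> (N, False)" for u
    by (rule wins_close[of _ "(N, False)"])
      (use that in \<open>auto simp: ladder_move_Cons intro: ladder_closes_wrap\<close>)
  show ?case
  proof (cases "c = N - 1")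
    case True
    show ?thesis
    proof (cases e)
      case False
      have "wins N w"
        by (rule wins_close[OF forward_run_move(1)[OF run]])
          (use True False start in \<open>auto intro: ladder_closes_wrap\<close>)
      then show ?thesis using True False by simp
    next
      case e: True
      \<comment> \<open>Both moves fail in the last column of row \<open>True\<close>: a step is
        answered by a flip to \<open>(N, False)\<close>, and a flip by a step to it.\<close>
      have "loses N w"
      proof (rule forward_run_loses[OF run])
        show "\<not> ladder_closes N ((c + 1, e) # w)"
          using not_ladder_closes_wrap[of True w N] True e start cols by force
        show "wins N ((c + 1, e) # w)"
          using wrap[of w] True e start by (simp add: v)
        show "\<not> ladder_closes N ((c, \<not> e) # w)" using not_closes_flip[OF run] less.prems by simp
        show "wins N ((c, \<not> e) # w)"
          by (rule wins_close[of _ "(N, False)"])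
            (use True e start in \<open>auto simp: ladder_move_Cons v intro: ladder_closes_wrap\<close>)
      qed
      then show ?thesis using True e by simp
    qed
  next
    case False
    then have c: "c + 1 < N" using less.prems by simp
    have step: "(even (N - (c + 1) + of_bool e) \<longrightarrow> loses N ((c + 1, e) # w)) \<and>
        (odd (N - (c + 1) + of_bool e) \<longrightarrow> wins N ((c + 1, e) # w))"
      by (rule less.hyps) (use c v start forward_run_step[OF run] in auto)
    show ?thesis
    proof (cases "even (N - c + of_bool e)")
      case odd: False
      then have "loses N ((c + 1, e) # w)" using step by (simp add: algebra_simps)
      then have "wins N w" by (rule wins_move[rotated]) simp
      then show ?thesis using odd by simp
    next
      case even: True
      let ?J = "(c + 2, \<not> e) # (c + 1, \<not> e) # (c, \<not> e) # w"
      have jump: "\<not> ladder_closes N ?J \<and> wins N ?J"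
      proof (cases "c + 2 = N")
        case True
        \<comment> \<open>Parity forces the run to be in row \<open>False\<close>, so the jump
          arrives at column \<open>N\<close> in row \<open>True\<close>, where nothing is closed and
          \<open>wrap\<close> applies.\<close>
        then have e: "\<not> e" using even by auto
        have "\<not> ladder_closes N ?J"
          using not_ladder_closes_wrap[of True "(c + 1, \<not> e) # (c, \<not> e) # w" N] True e start cols v
          by force
        moreover have "wins N ?J"
          using wrap[of "(c + 1, \<not> e) # (c, \<not> e) # w"] True e start by simp
        ultimately show ?thesis ..
      next
        case False
        then have "c + 2 < N" using c by simp
        moreover have "(even (N - (c + 2) + of_bool (\<not> e)) \<longrightarrow> loses N ?J) \<and>
            (odd (N - (c + 2) + of_bool (\<not> e)) \<longrightarrow> wins N ?J)"
          by (rule less.hyps) (use \<open>c + 2 < N\<close> v start forward_run_jump[OF run] in auto)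
        moreover have "odd (N - (c + 2) + of_bool (\<not> e))" using even by (cases e) auto
        ultimately show ?thesis using not_closes_jump[OF run] by blast
      qed
      have "loses N w"
      proof (rule forward_run_loses[OF run])
        show "wins N ((c + 1, e) # w)" using step even by (simp add: algebra_simps)
        show "wins N ((c, \<not> e) # w)" using wins_after_flip[OF run c] jump by blast
      qed (use not_closes_step[OF run] not_closes_flip[OF run] c in auto)
      then show ?thesis using even by simp
    qed
  qed
qed

text \<open>Whoever enters column \<open>N\<close> closes a cycle in either row and wins. A step
  uses up one of the \<open>N - c\<close> remaining columns, a flip with its forced continuation
  two, and both leave the opponent to move; so the multiples of 3 are the losing positions.\<close>

lemma closed_start_outcome:
  assumes "forward_run c e w" "c < N" "(0, False) \<in> set w" "(0, True) \<in> set w"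
  shows "(3 dvd N - c \<longrightarrow> loses N w) \<and> (\<not> 3 dvd N - c \<longrightarrow> wins N w)"
  using assms
proof (induction "nat (N - c)" arbitrary: c e w rule: less_induct)
  case less
  note run = less.prems(1) and start = less.prems(3,4)
  note [simp] = forward_run_move[OF run]
  have start': "(0, f) \<in> set w" for f using start by (cases f) auto
  obtain v where v: "w = (c, e) # (c - 1, e) # v" "1 \<le> c"
    by (rule forward_runE[OF run])
  show ?case
  proof (cases "c = N - 1")
    case True
    have "wins N w"
      by (rule wins_close[OF forward_run_move(1)[OF run]])
        (use True start' in \<open>auto intro: ladder_closes_wrap\<close>)
    then show ?thesis using True by simp
  next
    case False
    then have c: "c + 1 < N" using less.prems by simp
    have step: "(3 dvd N - (c + 1) \<longrightarrow> loses N ((c + 1, e) # w)) \<and>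
        (\<not> 3 dvd N - (c + 1) \<longrightarrow> wins N ((c + 1, e) # w))"
      by (rule less.hyps) (use c start forward_run_step[OF run] in auto)
    let ?G = "(c + 1, \<not> e) # (c, \<not> e) # w"
    let ?J = "(c + 2, \<not> e) # ?G"
    have jump: "(3 dvd N - (c + 2) \<longrightarrow> loses N ?J) \<and> (\<not> 3 dvd N - (c + 2) \<longrightarrow> wins N ?J)"
      if "c + 2 < N"
      by (rule less.hyps) (use that start forward_run_jump[OF run] in auto)
    have "3 dvd N - c \<or> 3 dvd N - (c + 1) \<or> 3 dvd N - (c + 2)"
      by presburger
    then consider "3 dvd N - c" | "3 dvd N - (c + 1)" | "3 dvd N - (c + 2)"
      by blast
    then show ?thesis
    proof cases
      case 1
      \<comment> \<open>A multiple of 3 above 1 is at least 3, so neither option reaches column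
        \<open>N\<close>, and neither leaves a multiple of 3.\<close>
      then have "c + 2 < N" "\<not> 3 dvd N - (c + 2)" "\<not> 3 dvd N - (c + 1)" using c by presburger+
      then have "loses N w"
        using jump step c not_closes_jump[OF run] wins_after_flip[OF run c]
          not_closes_step[OF run] not_closes_flip[OF run]
        by (intro forward_run_loses[OF run]) auto
      then show ?thesis using 1 by simp
    next
      case 2
      then have "wins N w" using step by (intro wins_move[of w "(c + 1, e)"]) auto
      moreover have "\<not> 3 dvd N - c" using 2 by presburger
      ultimately show ?thesis by simp
    next
      case 3
      \<comment> \<open>The flip removes two columns. Once the opponent has made the forced step,
        the flipper steps to \<open>c + 2\<close>, which closes at once if this is column
        \<open>N\<close> and otherwise leaves a multiple of 3.\<close>
      have "wins N ?G"
      proof (cases "c + 2 = N")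
        case True
        show ?thesis
          by (rule wins_close[of _ "(N, \<not> e)"])
            (use True start' in \<open>auto simp: ladder_move_Cons intro!: ladder_closes_wrap\<close>)
      next
        case False
        then show ?thesis
          using jump 3 c by (intro wins_move[of ?G "(c + 2, \<not> e)"]) (auto simp: ladder_move_Cons)
      qed
      then have "loses N ((c, \<not> e) # w)" by (rule loses_after_flip[OF run c])
      then have "wins N w" by (intro wins_move[of w "(c, \<not> e)"]) auto
      moreover have "\<not> 3 dvd N - c" using 3 by presburger
      ultimately show ?thesis by simp
    qed
  qed
qed


section \<open>The opening moves\<close>

text \<open>The run starts at \<open>c = 1\<close> in row \<open>False\<close> with
  \<open>(0, True)\<close> unvisited, so the parity of \<open>N - 1\<close> decides.\<close>

lemma rotation_opening:
  assumes "N \<ge> 3"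
  shows "odd N \<Longrightarrow> loses N [(1, False), (0, False)]" "even N \<Longrightarrow> wins N [(1, False), (0, False)]"
proof -
  have "forward_run 1 False [(1, False), (0, False)]" by (simp add: forward_run_def)
  from open_start_outcome[OF this, of N] assms
  show "odd N \<Longrightarrow> loses N [(1, False), (0, False)]" "even N \<Longrightarrow> wins N [(1, False), (0, False)]"
    by auto
qed

lemma flip_opening:
  assumes "N \<ge> 3"
  shows "[N = 2] (mod 3) \<Longrightarrow> loses N [(0, True), (0, False)]"
    and "\<not> [N = 2] (mod 3) \<Longrightarrow> wins N [(0, True), (0, False)]"
proof -
  let ?u = "[(1, True), (0, True), (0, False)] :: (int \<times> bool) list"
  \<comment> \<open>The run can only start in column 2: in column 1 the vertex behind and across is
    \<open>(0, False)\<close>, which is visited. Both vertices of column 0 are visited, so the count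
    modulo 3 applies with \<open>N - 2\<close> columns left.\<close>
  have run: "forward_run 2 True ((2, True) # ?u)" by (auto simp: forward_run_def)
  have iff: "3 dvd N - 2 \<longleftrightarrow> [N = 2] (mod 3)" by (metis cong_iff_dvd_diff)
  note out = closed_start_outcome[OF run, of N, unfolded iff]
  have nc: "\<not> ladder_closes N ((k, e) # u)"
    if "(k, e) \<notin> set u" "\<forall>y\<in>set u. 0 \<le> fst y \<and> fst y < 3" "0 \<le> k" "k < 3" for k e u
    using that assms by (intro not_ladder_closes) auto
  {
    assume "[N = 2] (mod 3)"
    then have "loses N ((2, True) # ?u)" using out assms by auto
    then have u: "wins N ?u" by (rule wins_move[rotated]) (simp add: ladder_move_Cons)
    show "loses N [(0, True), (0, False)]"
    proof (rule loses)
      fix y assume "ladder_move [(0, True), (0, False)] y"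
      then consider "y = (1, True)" | "y = (- 1, True)" by (auto simp: ladder_move_Cons)
      then have "\<not> ladder_closes N [y, (0, True), (0, False)] \<and> wins N [y, (0, True), (0, False)]"
      proof cases
        case 1
        then show ?thesis using u nc by auto
      next
        case 2
        have "\<not> ladder_closes N ?u" using nc by auto
        then show ?thesis
          using wins_loses_mirror(1)[OF u] ladder_closes_mirror[of ?u N] 2 by (simp add: mirror_def)
      qed
      then show "\<not> ladder_closes N [y, (0, True), (0, False)]" "wins N [y, (0, True), (0, False)]"
        by simp_all
    qed
  next
    assume "\<not> [N = 2] (mod 3)"
    then have w: "wins N ((2, True) # ?u)" using out assms by auto
    have "loses N ?u"
    proof (rule loses)
      fix y assume "ladder_move ?u y"
      then consider "y = (2, True)" | "y = (1, False)" by (auto simp: ladder_move_Cons)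
      then have "\<not> ladder_closes N (y # ?u) \<and> wins N (y # ?u)"
      proof cases
        case 1
        then show ?thesis using w nc by auto
      next
        \<comment> \<open>Flipping in column 1 lets the opponent step back onto the starting vertex,
          so the second step forward is forced.\<close>
        case 2
        have "wins N ((1, False) # ?u)"
          by (rule wins_close[of _ "(0, False)"])
            (auto simp: ladder_move_Cons intro: ladder_closes_mem)
        then show ?thesis using 2 nc by auto
      qed
      then show "\<not> ladder_closes N (y # ?u)" "wins N (y # ?u)" by simp_all
    qed
    then show "wins N [(0, True), (0, False)]"
      by (intro wins_move[of _ "(1, True)"]) (auto simp: ladder_move_Cons)
  }
qed

lemma ladder_game_odd:
  assumes "N \<ge> 3" "odd N"
  shows "wins N [(0, False)]"
  using rotation_opening[OF assms(1)] assms
  by (intro wins_move[of _ "(1, False)"]) (auto simp: ladder_move_Cons)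

lemma ladder_game_even:
  assumes "N \<ge> 3" "even N"
  shows "[N = 2] (mod 3) \<Longrightarrow> wins N [(0, False)]"
    and "\<not> [N = 2] (mod 3) \<Longrightarrow> loses N [(0, False)]"
proof -
  assume "[N = 2] (mod 3)"
  then show "wins N [(0, False)]"
    using flip_opening[OF assms(1)]
    by (intro wins_move[of _ "(0, True)"]) (auto simp: ladder_move_Cons)
next
  assume N: "\<not> [N = 2] (mod 3)"
  have r: "wins N [(1, False), (0, False)]" using rotation_opening assms by simp
  show "loses N [(0, False)]"
  proof (rule loses)
    fix y assume "ladder_move [(0, False)] y"
    then consider "y = (1, False)" | "y = (- 1, False)" | "y = (0, True)"
      by (auto simp: ladder_move_Cons)
    note y = this
    \<comment> \<open>A single rotation cannot return to the start, so no opening move closes a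
      cycle.\<close>
    have "1 mod N \<noteq> 0" "(- 1) mod N \<noteq> 0" using assms by (auto simp: zmod_minus1)
    with y show "\<not> ladder_closes N [y, (0, False)]"
      by cases (auto simp: ladder_closes_Cons cong_def)
    from y show "wins N [y, (0, False)]"
    proof cases
      case 2
      then show ?thesis using wins_loses_mirror(1)[OF r] by (simp add: mirror_def)
    qed (use r flip_opening(2)[OF assms(1) N] in auto)
  qed
qed


section \<open>From the ladder to the dihedral group\<close>

text \<open>An invariant that \<open>p\<close> can always maintain and the opponent cannot break
  yields a strategy by choosing maintaining moves. It also guarantees \<open>p\<close> a legal move,
  so only the opponent can get stuck.\<close>

lemma has_winning_strategyI:
  assumes start: "I []"
    and own: "\<And>ms. I ms \<Longrightarrow> \<not> closes_relator G ms \<Longrightarrow> player_to_move ms = p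
      \<Longrightarrow> \<exists>s. legal_move G S ms s \<and> I (ms @ [s])"
    and other: "\<And>ms s. I ms \<Longrightarrow> \<not> closes_relator G ms \<Longrightarrow> player_to_move ms \<noteq> p
      \<Longrightarrow> legal_move G S ms s \<Longrightarrow> I (ms @ [s])"
    and final: "\<And>ms. I ms \<Longrightarrow> closes_relator G ms \<Longrightarrow> player_to_move (butlast ms) = p"
  shows "has_winning_strategy G S p"
proof -
  define \<sigma> where "\<sigma> ms = (SOME s. legal_move G S ms s \<and> I (ms @ [s]))" for ms
  have \<sigma>: "legal_move G S ms (\<sigma> ms) \<and> I (ms @ [\<sigma> ms])"
    if "I ms" "\<not> closes_relator G ms" "player_to_move ms = p" for ms
    unfolding \<sigma>_def using own[OF that] by (rule someI_ex)
  have inv: "I ms" if "rel_position G S ms" "follows p \<sigma> ms" for ms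
    using that
  proof induction
    case start
    show ?case by (rule assms(1))
  next
    case (move ms s)
    have "\<forall>k<Suc (length ms). player_to_move (take k (ms @ [s])) = p
        \<longrightarrow> (ms @ [s]) ! k = \<sigma> (take k (ms @ [s]))"
      using move.prems by (simp add: follows_def)
    then have "follows p \<sigma> ms" and s: "player_to_move ms = p \<longrightarrow> s = \<sigma> ms"
      by (auto simp: follows_def nth_append all_conj_distrib less_Suc_eq)
    then show ?case using move \<sigma> other by (cases "player_to_move ms = p") auto
  qed
  have "winning_strategy G S p \<sigma>"
    unfolding winning_strategy_def
  proof (intro conjI allI impI; elim conjE)
    fix ms assume ms: "rel_position G S ms" "follows p \<sigma> ms"
    {
      assume "\<not> rel_over G S ms" "player_to_move ms = p"
      then show "legal_move G S ms (\<sigma> ms)" using \<sigma> inv[OF ms] by (simp add: rel_over_def)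
    next
      assume over: "rel_over G S ms"
      show "rel_winner G ms = p"
      proof (cases "closes_relator G ms")
        case True
        then show ?thesis using final inv[OF ms] by (simp add: rel_winner_def)
      next
        case False
        then have "player_to_move ms \<noteq> p" using own inv[OF ms] over by (auto simp: rel_over_def)
        then show ?thesis
          using False by (cases p; cases "player_to_move ms") (auto simp: rel_winner_def)
      qed
    }
  qed
  then show ?thesis by (auto simp: has_winning_strategy_def)
qed

section \<open>Lifting words to ladder walks\<close>

definition ladder_walk :: "dihedral_gen gword \<Rightarrow> (int \<times> bool) list" where
  "ladder_walk u = foldl (\<lambda>w x. ladder_step (hd w) x # w) [(0, False)] u"

lemma ladder_walk_Nil [simp]: "ladder_walk [] = [(0, False)]"
  by (simp add: ladder_walk_def)

lemma ladder_walk_snoc [simp]: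
  "ladder_walk (u @ [x]) = ladder_step (hd (ladder_walk u)) x # ladder_walk u"
  by (simp add: ladder_walk_def)

text \<open>Reducing columns modulo \<open>n\<close> is the covering map; it commutes with every
  letter.\<close>

lemma dihedral_act_ladder_walk:
  "foldl (dihedral_act n) (0, False) u = apfst (\<lambda>i. i mod int n) (hd (ladder_walk u))"
proof (induction u rule: rev_induct)
  case (snoc x u)
  obtain i e where "hd (ladder_walk u) = (i, e)" by force
  then show ?case using snoc by (cases x; cases "fst x") (auto simp: mod_simps)
qed simp

lemma set_tl_ladder_walk:
  "set (tl (ladder_walk u)) = (\<lambda>k. hd (ladder_walk (take k u))) ` {..<length u}"
proof (induction u rule: rev_induct)
  case (snoc x u)
  have "set (ladder_walk u) = insert (hd (ladder_walk u)) (set (tl (ladder_walk u)))"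
    by (cases u rule: rev_cases) auto
  then show ?case using snoc by (simp add: lessThan_Suc)
qed simp

lemma word_value_letters:
  "word_value (dihedral_group n) (map (\<lambda>x. gword_class (dihedral_relators n) [x]) u)
     = gword_class (dihedral_relators n) u"
  by (induction u rule: rev_induct)
    (simp_all add: word_value_def dihedral_group_def presented_group_one gword_class_mult)

text \<open>This solves the word problem: the action respects the relators, and conversely the
  normal form depends only on the evaluated pair.\<close>

lemma gword_class_dihedral_eq_iff:
  assumes "n > 0"
  shows "gword_class (dihedral_relators n) u = gword_class (dihedral_relators n) v \<longleftrightarrow>
    foldl (dihedral_act n) (0, False) u = foldl (dihedral_act n) (0, False) v"
proof
  assume "gword_class (dihedral_relators n) u = gword_class (dihedral_relators n) v"
  then show "foldl (dihedral_act n) (0, False) u = foldl (dihedral_act n) (0, False) v"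
    using assms by (intro dihedral_act_rel_eq) (simp_all add: gword_class_eq_iff)
next
  assume "foldl (dihedral_act n) (0, False) u = foldl (dihedral_act n) (0, False) v"
  then show "gword_class (dihedral_relators n) u = gword_class (dihedral_relators n) v"
    by (simp add: dihedral_normal_form)
qed

lemma closes_relator_letters:
  assumes "n > 0"
  shows "closes_relator (dihedral_group n) (map (\<lambda>x. gword_class (dihedral_relators n) [x]) u)
    \<longleftrightarrow> ladder_closes (int n) (ladder_walk u)"
proof -
  have "apfst (\<lambda>i. i mod int n) p = apfst (\<lambda>i. i mod int n) q \<longleftrightarrow>
      [fst p = fst q] (mod int n) \<and> snd p = snd q" for p q :: "int \<times> bool"
    by (cases p; cases q) (simp add: cong_def)
  then show ?thesis
    by (auto simp: closes_relator_def ladder_closes_def set_tl_ladder_walk take_map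
        word_value_letters gword_class_dihedral_eq_iff[OF assms] dihedral_act_ladder_walk)
qed

lemma dihedral_moves:
  "{dihedral_r n, dihedral_s n} \<union> m_inv (dihedral_group n) ` {dihedral_r n, dihedral_s n}
     = range (\<lambda>x. gword_class (dihedral_relators n) [x])"
proof -
  have "(UNIV :: (dihedral_gen \<times> bool) set) = {Rot, Flip} \<times> {True, False}"
    by (metis UNIV_Times_UNIV UNIV_bool UNIV_dihedral_gen insert_commute)
  then have U: "(UNIV :: (dihedral_gen \<times> bool) set)
      = {(Rot, True), (Flip, True), (Rot, False), (Flip, False)}" by auto
  show ?thesis
    unfolding U by (simp add: dihedral_r_def dihedral_s_def presented_gen_def dihedral_group_def
        presented_group_inv_letter insert_commute)
qed

lemma inv_letter:
  "m_inv (dihedral_group n) (gword_class (dihedral_relators n) [(a, b)])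
     = gword_class (dihedral_relators n) [(a, \<not> b)]"
proof -
  interpret group "dihedral_group n" by (rule group_dihedral_group)
  have "gword_class (dihedral_relators n) [(a, True)] \<in> carrier (dihedral_group n)"
    by (simp add: dihedral_group_def presented_group_def)
  then show ?thesis
    using presented_group_inv_letter[of "dihedral_relators n" a]
    by (cases b) (simp_all add: dihedral_group_def[symmetric])
qed

text \<open>The group bans an element, the ladder a vertex. Both letters of \<open>Flip\<close> give
  the same element and the same edge, while \<open>n \<ge> 3\<close> separates \<open>r\<close> from
  its inverse.\<close>

lemma letter_eq_inv_iff:
  assumes "n \<ge> 3"
  shows "gword_class (dihedral_relators n) [x] = gword_class (dihedral_relators n) [(a, \<not> b)]
    \<longleftrightarrow> ladder_step (ladder_step p (a, b)) x = p"
proof -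
  obtain i e where p: "p = (i, e)" by force
  obtain c d where x: "x = (c, d)" by force
  have "(- 1) mod int n = int n - 1" "1 mod int n = 1" using assms by (auto simp: zmod_minus1)
  then show ?thesis
    using assms by (cases a; cases c; cases b; cases d; cases e)
      (simp_all add: p x gword_class_dihedral_eq_iff)
qed

lemma legal_move_letters:
  assumes "n \<ge> 3"
  shows "legal_move (dihedral_group n) {dihedral_r n, dihedral_s n}
      (map (\<lambda>x. gword_class (dihedral_relators n) [x]) u) (gword_class (dihedral_relators n) [x])
    \<longleftrightarrow> ladder_move (ladder_walk u) (ladder_step (hd (ladder_walk u)) x)"
proof (cases u rule: rev_cases)
  case Nil
  then show ?thesis unfolding legal_move_def dihedral_moves by (cases x) (auto simp: ladder_move_def)
next
  case (snoc v y)
  obtain a b where y: "y = (a, b)" by force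
  obtain c d where x: "x = (c, d)" by force
  have "ladder_walk v \<noteq> []" by (cases v rule: rev_cases) auto
  then show ?thesis
    using letter_eq_inv_iff[OF assms, of x a b "hd (ladder_walk v)"]
    unfolding legal_move_def dihedral_moves by (auto simp: snoc x y ladder_move_def inv_letter)
qed

lemma has_winning_strategy_ladder:
  assumes n: "n \<ge> 3"
    and init: "if p = Player1 then wins (int n) [(0, False)] else loses (int n) [(0, False)]"
  shows "has_winning_strategy (dihedral_group n) {dihedral_r n, dihedral_s n} p"
proof -
  let ?G = "dihedral_group n" and ?S = "{dihedral_r n, dihedral_s n}"
  define L where "L = map (\<lambda>x. gword_class (dihedral_relators n) [x])"
  have L_snoc: "L u @ [gword_class (dihedral_relators n) [x]] = L (u @ [x])" for u x
    by (simp add: L_def)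
  have closes: "closes_relator ?G (L u) \<longleftrightarrow> ladder_closes (int n) (ladder_walk u)" for u
    using closes_relator_letters[of n u] n by (simp add: L_def)
  note legal = legal_move_letters[OF n, folded L_def]
  have turn: "player_to_move (ms @ [x]) = p \<longleftrightarrow> player_to_move ms \<noteq> p" for ms and x :: 'a
    by (cases p) (auto simp: player_to_move_def)
  \<comment> \<open>On a closed walk \<open>butlast\<close> identifies who made the closing move.
    The invariant lives on formal words, and distinct words can give the same list of group
    elements, so it is used below with an existential.\<close>
  define J where "J u \<longleftrightarrow>
    (if ladder_closes (int n) (ladder_walk u) then player_to_move (butlast u) = p
     else if player_to_move u = p then wins (int n) (ladder_walk u)
     else loses (int n) (ladder_walk u))" for u
  have len: "player_to_move (L u) = player_to_move u"
    "player_to_move (butlast (L u)) = player_to_move (butlast u)" for u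
    by (simp_all add: L_def player_to_move_def)
  show ?thesis
  proof (rule has_winning_strategyI[where I = "\<lambda>ms. \<exists>u. ms = L u \<and> J u"])
    have "J []" using init by (cases p) (auto simp: J_def ladder_closes_def player_to_move_def)
    then show "\<exists>u. [] = L u \<and> J u" by (intro exI[of _ "[]"]) (simp add: L_def)
  next
    fix ms assume "\<exists>u. ms = L u \<and> J u" and nc: "\<not> closes_relator ?G ms"
      and p: "player_to_move ms = p"
    then obtain u where u: "ms = L u" "J u" by blast
    have "wins (int n) (ladder_walk u)" using u nc p by (simp add: J_def closes len)
    then obtain y where y: "ladder_move (ladder_walk u) y"
      "ladder_closes (int n) (y # ladder_walk u) \<or> loses (int n) (y # ladder_walk u)"
      by cases auto
    then obtain x where x: "y = ladder_step (hd (ladder_walk u)) x"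
      by (auto simp: ladder_move_def)
    have "J (u @ [x])" using y(2) p turn[of u x] by (auto simp: J_def x u len)
    then show "\<exists>s. legal_move ?G ?S ms s \<and> (\<exists>u. ms @ [s] = L u \<and> J u)"
      using legal[of u x] y x u L_snoc by blast
  next
    fix ms s assume "\<exists>u. ms = L u \<and> J u" and nc: "\<not> closes_relator ?G ms"
      and p: "player_to_move ms \<noteq> p" and s: "legal_move ?G ?S ms s"
    then obtain u where u: "ms = L u" "J u" by blast
    have lose: "loses (int n) (ladder_walk u)" using u nc p by (simp add: J_def closes len)
    obtain x where x: "s = gword_class (dihedral_relators n) [x]"
      using s unfolding legal_move_def dihedral_moves by blast
    have "ladder_move (ladder_walk u) (ladder_step (hd (ladder_walk u)) x)"
      using legal s by (simp add: u x)
    \<comment> \<open>Inverting \<open>loses\<close>: no move of the opponent closes, and each one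
      leaves \<open>p\<close> in a winning position.\<close>
    with lose have "\<not> ladder_closes (int n) (ladder_walk (u @ [x])) \<and>
        wins (int n) (ladder_walk (u @ [x]))"
      by cases auto
    then have "J (u @ [x])"
      using p turn[of u x] by (simp add: J_def u len)
    then show "\<exists>u. ms @ [s] = L u \<and> J u" using u x L_snoc by blast
  next
    fix ms assume "\<exists>u. ms = L u \<and> J u" "closes_relator ?G ms"
    then show "player_to_move (butlast ms) = p" by (auto simp: J_def closes len)
  qed
qed

theorem theorem3p2:
  fixes n :: nat
  assumes "n \<ge> 3"
  shows "(odd n \<longrightarrow>
            has_winning_strategy (dihedral_group n) {dihedral_r n, dihedral_s n} Player1) \<and>
         (even n \<longrightarrow>
            (if [n = 2] (mod 6)
             then has_winning_strategy (dihedral_group n) {dihedral_r n, dihedral_s n} Player1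
             else has_winning_strategy (dihedral_group n) {dihedral_r n, dihedral_s n} Player2))"
proof -
  have N: "int n \<ge> 3" using assms by simp
  have mod6: "[int n = 2] (mod 3) \<longleftrightarrow> [n = 2] (mod 6)" if n: "even n"
  proof -
    have "[int n = 2] (mod 3) \<longleftrightarrow> [n = 2] (mod 3)" using cong_int_iff[of n 2 3] by simp
    also have "\<dots> \<longleftrightarrow> [n = 2] (mod 6)"
    proof -
      \<comment> \<open>With \<open>n = 2 * m\<close>, both congruences say that \<open>m\<close> is
        1 modulo 3.\<close>
      obtain m where m: "n = 2 * m" using n by blast
      have "(2 * m) mod 6 = 2 * (m mod 3)" by (simp add: mult_mod_right)
      moreover have "(2 * m) mod 3 = 2 \<longleftrightarrow> m mod 3 = 1" by presburger
      ultimately show ?thesis by (simp add: cong_def m)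
    qed
    finally show ?thesis .
  qed
  note strat = has_winning_strategy_ladder[OF assms]
  show ?thesis
    using ladder_game_odd[OF N] ladder_game_even[OF N] mod6
    by (auto intro!: strat)
qed

end
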